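(* Let $n_1,\dots,n_u$ be positive integers, $n=\sum_{i=1}^u n_i$, and let $\boldsymbol{d}=(d_1,\dots,d_n)^T$ be an arbitrary column of an $\mathrm{FSLHD}(n_1,\dots,n_u;u,q)$ generated by the column-construction algorithm described in the context, with slices $\boldsymbol{d}^1,\dots,\boldsymbol{d}^u$, where $\boldsymbol{d}^i=(d^i_1,\dots,d^i_{n_i})^T$. Then: (i) each of the $n$ intervals $(0,1/n],(1/n,2/n],\dots,((n-1)/n,1]$ contains precisely one of the points $d_1,\dots,d_n$; (ii) for every $i=1,\dots,u$, each of the $n_i$ intervals $(0,1/n_i],(1/n_i,2/n_i],\dots,((n_i-1)/n_i,1]$ contains precisely one of the points $d^i_1,\dots,d^i_{n_i}$.
   Context: For real $a$, $\lceil a\rceil$ is the smallest integer not smaller than $a$. Given positive integers $n_1,\dots,n_u$, put $n=\sum_{i=1}^u n_i$ and $L=\mathrm{lcm}(n_1,\dots,n_u,n)$. A flexible sliced Latin hypercube design $\mathrm{FSLHD}(n_1,\dots,n_u;u,q)$ is an $n\times q$ design matrix with $u$ slices (consecutive blocks of rows) of run sizes $n_1,\dots,n_u$ and $q$ factors (columns). Each of its $q$ columns is generated independently by the following algorithm. Step 1. Set $H^i=\varnothing$ for $i=1,\dots,u$, and $R_0=\varnothing$. Step 2. For $j=1,2,\dots,n$ in this order: let $R_{j,0}=R_{j-1}\cup\{j\}$ and $$\theta_j=\sum_{i=1}^u\left(\lceil n_i(j+1)/n\rceil-\lceil n_i j/n\rceil\right).$$ (Each summand is $0$ or $1$.) If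 $\theta_j>0$, then for $k=1,\dots,\theta_j$ in this order: let $l$ be the $k$-th smallest element of the set $\{p\in\{1,\dots,u\} : \lceil n_p(j+1)/n\rceil-\lceil n_p j/n\rceil=1\}$, let $$r=\min\{\,r' \in R_{j,k-1} : \lceil n_l r'/n\rceil=\lceil n_l j/n\rceil\,\},$$ add $r$ to $H^l$, and let $R_{j,k}=R_{j,k-1}\setminus\{r\}$. After this, let $R_j=R_{j,\theta_j}$ (so $R_j=R_{j,0}$ if $\theta_j=0$) and go on to the next $j$. Step 3. For $i=1,\dots,u$, let $\boldsymbol{h}^i$ be a vector obtained by randomly permuting the elements of $H^i$ (any ordering may occur). Step 4. For $i=1,\dots,u$, let $\boldsymbol{m}^i=L\boldsymbol{h}^i/n=(m^i_1,\dots,m^i_{n_i})$, and define the slice $\boldsymbol{d}^i=(d^i_1,\dots,d^i_{n_i})^T$ by $$d^i_s=(m^i_s-\varepsilon^i_s)/L,\qquad s=1,\dots,n_i,$$ where $\varepsilon^i_s\sim U(0,1)$, i.e. $\varepsilon^i_s$ is a random number drawn uniformly from the open interval $(0,1)$. The column is the $n$-dimensional vector $\boldsymbol{d}=(d_1,\dots,d_n)^T$ obtained by concatenating $\boldsymbol{d}^1,\dots,\boldsymbol{d}^u$. *)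

theory Defs
  imports Complex_Main "HOL-Combinatorics.Multiset_Permutations"
begin

text \<open>
  Slices are indexed by \<open>{1..u}\<close> and \<open>ns i\<close> is the run size of slice \<open>i\<close>. Vectors are lists, so
  entry \<open>s\<close> of a vector is \<open>v ! (s - 1)\<close>.
\<close>

definition run_total :: "nat \<Rightarrow> (nat \<Rightarrow> nat) \<Rightarrow> nat" where
  "run_total u ns = (\<Sum>i=1..u. ns i)"

definition run_lcm :: "nat \<Rightarrow> (nat \<Rightarrow> nat) \<Rightarrow> nat" where
  "run_lcm u ns = Lcm (insert (run_total u ns) (ns ` {1..u}))"

definition level :: "nat \<Rightarrow> (nat \<Rightarrow> nat) \<Rightarrow> nat \<Rightarrow> nat \<Rightarrow> int" where
  "level u ns i j = \<lceil>real (ns i) * real j / real (run_total u ns)\<rceil>"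

definition theta :: "nat \<Rightarrow> (nat \<Rightarrow> nat) \<Rightarrow> nat \<Rightarrow> nat" where
  "theta u ns j = nat (\<Sum>i=1..u. level u ns i (j + 1) - level u ns i j)"

definition jump_slices :: "nat \<Rightarrow> (nat \<Rightarrow> nat) \<Rightarrow> nat \<Rightarrow> nat set" where
  "jump_slices u ns j = {p \<in> {1..u}. level u ns p (j + 1) - level u ns p j = 1}"

text \<open>
  A state \<open>(R, H)\<close> of the algorithm holds the current remainder set \<open>R\<close> and the current sets \<open>H i\<close>.
  \<open>inner_state u ns j S k\<close> is the state after \<open>k\<close> inner iterations of round \<open>j\<close>, where \<open>S\<close> is
  the state at the end of round \<open>j - 1\<close>. The choice of \<open>r\<close> is only meaningful if the candidate set
  is nonempty; that it always is, is not assumed here.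
\<close>

primrec inner_state ::
  "nat \<Rightarrow> (nat \<Rightarrow> nat) \<Rightarrow> nat \<Rightarrow> nat set \<times> (nat \<Rightarrow> nat set) \<Rightarrow> nat \<Rightarrow> nat set \<times> (nat \<Rightarrow> nat set)"
where
  "inner_state u ns j S 0 = (insert j (fst S), snd S)"
| "inner_state u ns j S (Suc k) =
    (let (R, H) = inner_state u ns j S k;
         l = sorted_list_of_set (jump_slices u ns j) ! k;
         r = Min {r' \<in> R. level u ns l r' = level u ns l j}
     in (R - {r}, H(l := insert r (H l))))"

primrec outer_state :: "nat \<Rightarrow> (nat \<Rightarrow> nat) \<Rightarrow> nat \<Rightarrow> nat set \<times> (nat \<Rightarrow> nat set)" where
  "outer_state u ns 0 = ({}, \<lambda>i. {})"
| "outer_state u ns (Suc j) =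
    inner_state u ns (Suc j) (outer_state u ns j) (theta u ns (Suc j))"

definition slice_set :: "nat \<Rightarrow> (nat \<Rightarrow> nat) \<Rightarrow> nat \<Rightarrow> nat set" where
  "slice_set u ns i = snd (outer_state u ns (run_total u ns)) i"

text \<open>
  The random choices (the orderings and the numbers in the open unit interval) are represented by
  their possible outcomes: the predicates below hold of everything that the algorithm can produce.
  The length of a generated slice is \<open>card (slice_set u ns i)\<close>; it is not prescribed to be \<open>ns i\<close>.
\<close>

definition generated_slice :: "nat \<Rightarrow> (nat \<Rightarrow> nat) \<Rightarrow> nat \<Rightarrow> real list \<Rightarrow> bool" where
  "generated_slice u ns i ds \<longleftrightarrow>
    (\<exists>h m \<epsilon>. h \<in> permutations_of_set (slice_set u ns i) \<and>
       m = map (\<lambda>x. real (run_lcm u ns) * real x / real (run_total u ns)) h \<and>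
       length \<epsilon> = length h \<and> set \<epsilon> \<subseteq> {0<..<1} \<and>
       ds = map2 (\<lambda>x e. (x - e) / real (run_lcm u ns)) m \<epsilon>)"

definition generated_column :: "nat \<Rightarrow> (nat \<Rightarrow> nat) \<Rightarrow> (nat \<Rightarrow> real list) \<Rightarrow> real list \<Rightarrow> bool" where
  "generated_column u ns ds d \<longleftrightarrow>
    (\<forall>i\<in>{1..u}. generated_slice u ns i (ds i)) \<and> d = concat (map ds [1..<Suc u])"

text \<open>The design matrix is given by the list of its \<open>q\<close> columns.\<close>

definition FSLHD :: "nat \<Rightarrow> (nat \<Rightarrow> nat) \<Rightarrow> nat \<Rightarrow> real list list \<Rightarrow> bool" where
  "FSLHD u ns q D \<longleftrightarrow> length D = q \<and> (\<forall>d\<in>set D. \<exists>ds. generated_column u ns ds d)"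

end

theory Submission
  imports Defs
begin

text \<open>
  Write \<open>n\<close> for the total run size and call \<open>\<lceil>n\<^sub>i r / n\<rceil>\<close> the level of the row index \<open>r\<close> in slice
  \<open>i\<close>. The level function of slice \<open>i\<close> cuts \<open>{1..n}\<close> into \<open>n\<^sub>i\<close> consecutive windows, and slice \<open>i\<close>
  jumps at \<open>j\<close> precisely when \<open>j\<close> is the right end of one of them. So the algorithm treats the
  pairs \<open>(i, j)\<close> with \<open>i\<close> jumping at \<open>j\<close> as unit jobs with deadline \<open>j\<close>: in order of
  deadline, each job receives the smallest free row index of its window. A run that never gets stuck
  produces sets \<open>H\<^sup>i\<close> that are disjoint and meet every window of slice \<open>i\<close> exactly once. There
  are \<open>n\<^sub>1 + \<dots> + n\<^sub>u = n\<close> jobs and \<open>n\<close> row indices, so these sets partition \<open>{1..n}\<close>.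

  The greedy run never gets stuck because Hall's condition holds (\<open>card_jobs_in_interval\<close>): the
  windows of slice \<open>i\<close> inside \<open>{c<..b}\<close> have levels strictly between those of \<open>c\<close> and \<open>b + 1\<close>,
  so there are fewer than \<open>n\<^sub>i (b + 1 - c) / n\<close> of them, and summing over \<open>i\<close> leaves fewer than
  \<open>b + 1 - c\<close> jobs in all. If the window of a job with deadline \<open>b\<close> were full, let \<open>c\<close> be
  the last free row index below it, or \<open>0\<close> if there is none. A job placed beyond \<open>c\<close> would have preferred \<open>c\<close>, had \<open>c\<close>
  been in its window; so all jobs placed in \<open>{c<..b}\<close>, together with the stuck one, have
  their windows inside \<open>{c<..b}\<close>, which is one job more than Hall's condition permits
  (\<open>greedy_not_stuck\<close>).

  Finally, the point built from \<open>r\<close> is \<open>r / n - \<epsilon> / L\<close>. As \<open>L\<close> is a common multiple of \<open>n\<close> and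
  all \<open>n\<^sub>i\<close>, the shift by less than \<open>1 / L\<close> crosses no cell boundary of either grid
  (\<open>jitter_preserves_cell\<close>): the cell of the point is the level of \<open>r\<close> in the slice,
  and \<open>r\<close> itself in the whole column.
\<close>

section \<open>Levels and their jumps\<close>

locale run_sizes =
  fixes u :: nat and ns :: "nat \<Rightarrow> nat"
  assumes slices_nonempty: "1 \<le> u"
    and run_size_pos: "i \<in> {1..u} \<Longrightarrow> 0 < ns i"
begin

abbreviation n :: nat where "n \<equiv> run_total u ns"

abbreviation lev :: "nat \<Rightarrow> nat \<Rightarrow> int" where "lev \<equiv> level u ns"

lemma run_size_le_total: "i \<in> {1..u} \<Longrightarrow> ns i \<le> n"
  unfolding run_total_def by (rule member_le_sum) auto

lemma total_pos: "0 < n"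
  using slices_nonempty run_size_pos[of 1] run_size_le_total[of 1] by simp

lemma level_0 [simp]: "lev i 0 = 0"
  by (simp add: level_def)

lemma level_mono: "r \<le> s \<Longrightarrow> lev i r \<le> lev i s"
  unfolding level_def by (intro ceiling_mono divide_right_mono mult_left_mono) auto

lemma level_Suc_le:
  assumes "i \<in> {1..u}"
  shows "lev i (Suc j) \<le> lev i j + 1"
proof -
  have "real (ns i) * real (Suc j) / real n = real (ns i) * real j / real n + real (ns i) / real n"
    by (simp add: field_simps add_divide_distrib)
  also have "\<dots> \<le> real (ns i) * real j / real n + 1"
    using run_size_le_total[OF assms] total_pos by simp
  finally show ?thesis
    unfolding level_def by linarith
qed

lemma level_pos: "i \<in> {1..u} \<Longrightarrow> 0 < j \<Longrightarrow> 0 < lev i j"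
  using run_size_pos total_pos by (simp add: level_def)

lemma level_total: "lev i n = int (ns i)"
  using total_pos by (simp add: level_def)

lemma level_Suc_total:
  assumes "i \<in> {1..u}"
  shows "lev i (Suc n) = int (ns i) + 1"
proof -
  have "real (ns i) * real (Suc n) / real n = real (ns i) + real (ns i) / real n"
    using total_pos by (simp add: field_simps)
  moreover have "0 < real (ns i) / real n"
    using run_size_pos[OF assms] total_pos by simp
  ultimately have "int (ns i) < lev i (Suc n)"
    unfolding level_def by linarith
  then show ?thesis
    using level_Suc_le[OF assms, of n] level_total[of i] by linarith
qed

lemma jump_slices_iff: "i \<in> jump_slices u ns j \<longleftrightarrow> i \<in> {1..u} \<and> lev i (Suc j) = lev i j + 1"
  unfolding jump_slices_def by auto

lemma finite_jump_slices: "finite (jump_slices u ns j)"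
  unfolding jump_slices_def by simp

lemma theta_eq_card: "theta u ns j = card (jump_slices u ns j)"
proof -
  have "(\<Sum>i=1..u. lev i (j + 1) - lev i j) = (\<Sum>i=1..u. if i \<in> jump_slices u ns j then 1 else 0)"
  proof (rule sum.cong[OF refl])
    fix i assume i: "i \<in> {1..u}"
    then show "lev i (j + 1) - lev i j = (if i \<in> jump_slices u ns j then 1 else 0)"
      using level_Suc_le[OF i, of j] level_mono[of j "Suc j" i] by (auto simp: jump_slices_iff)
  qed
  also have "\<dots> = int (card ({1..u} \<inter> jump_slices u ns j))"
    by (simp add: sum.If_cases)
  also have "{1..u} \<inter> jump_slices u ns j = jump_slices u ns j"
    by (auto simp: jump_slices_iff)
  finally show ?thesis
    by (simp add: theta_def)
qed

text \<open>The top level \<open>n\<^sub>i\<close> also ends in a jump, at \<open>n\<close>, because the level function is continued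
  to \<open>n + 1\<close>, where it has the value \<open>n\<^sub>i + 1\<close>.\<close>

lemma jump_at_every_level:
  assumes i: "i \<in> {1..u}" and k: "k \<in> {1..ns i}"
  obtains j where "j \<in> {1..n}" "i \<in> jump_slices u ns j" "lev i j = int k"
proof -
  define A where "A = {j \<in> {0..n}. lev i j \<le> int k}"
  define j where "j = Max A"
  have fin: "finite A" and "0 \<in> A"
    by (auto simp: A_def)
  then have "j \<in> A"
    unfolding j_def by (intro Max_in) auto
  then have j: "j \<le> n" "lev i j \<le> int k"
    by (auto simp: A_def)
  have above: "int k < lev i (Suc j)"
  proof (cases "j = n")
    case True
    then show ?thesis using level_Suc_total[OF i] k by simp
  next
    case False
    have "Suc j \<notin> A"
      using Max_ge[OF fin, of "Suc j"] unfolding j_def by auto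
    then show ?thesis using False j by (auto simp: A_def)
  qed
  with j level_Suc_le[OF i, of j] have *: "lev i j = int k" "lev i (Suc j) = lev i j + 1"
    by linarith+
  have "j \<noteq> 0"
    using * k by (metis level_0 atLeastAtMost_iff not_one_le_zero of_nat_eq_0_iff)
  then show thesis
    using that[of j] * j i by (auto simp: jump_slices_iff)
qed

section \<open>Hall's condition for the windows\<close>

definition jobs_upto :: "nat \<Rightarrow> (nat \<times> nat) set" where
  "jobs_upto m = {(i, j). j \<in> {1..m} \<and> i \<in> jump_slices u ns j}"

text \<open>For a job \<open>(i, j)\<close> the window is the whole level set of \<open>j\<close> (within the positive integers),
  since the level rises right after \<open>j\<close>.\<close>

definition window :: "nat \<times> nat \<Rightarrow> nat set" where
  "window p = {r \<in> {1..snd p}. lev (fst p) r = lev (fst p) (snd p)}"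

lemma finite_jobs_upto: "finite (jobs_upto m)"
proof (rule finite_subset)
  show "jobs_upto m \<subseteq> {1..u} \<times> {1..m}"
    by (auto simp: jobs_upto_def jump_slices_iff)
qed simp

lemma window_convex:
  assumes "r \<in> window p" "r \<le> s" "s \<le> snd p"
  shows "s \<in> window p"
  using assms level_mono[of r s "fst p"] level_mono[of s "snd p" "fst p"]
  by (auto simp: window_def)

lemma level_inj_on_jumps:
  assumes "i \<in> jump_slices u ns j" "i \<in> jump_slices u ns j'" "lev i j = lev i j'"
  shows "j = j'"
proof (rule ccontr)
  assume "j \<noteq> j'"
  then have "Suc j \<le> j' \<or> Suc j' \<le> j"
    by auto
  then show False
    using assms level_mono[of "Suc j" j' i] level_mono[of "Suc j'" j i]
    by (auto simp: jump_slices_iff)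
qed

text \<open>
  The levels of the counted windows lie strictly between \<open>lev i c\<close> and \<open>lev i (b + 1)\<close>.
  Rounding up may enlarge the difference of the two unrounded levels by almost \<open>1\<close>, but the
  strict bounds win this \<open>1\<close> back; this keeps the estimate strict in every slice.
\<close>

lemma card_jobs_of_slice:
  assumes i: "i \<in> {1..u}" and "c \<le> b"
    and J: "\<And>j. j \<in> J \<Longrightarrow> 1 \<le> j \<and> i \<in> jump_slices u ns j \<and> window (i, j) \<subseteq> {c<..b}"
  shows "real (card J) < real (ns i) * real (b + 1 - c) / real n"
proof (cases "J = {}")
  case True
  then show ?thesis
    using run_size_pos[OF i] total_pos \<open>c \<le> b\<close> by simp
next
  case False
  have sub: "lev i ` J \<subseteq> {lev i c<..<lev i (Suc b)}"
  proof (rule image_subsetI)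
    fix j assume "j \<in> J"
    then have j: "1 \<le> j" "i \<in> jump_slices u ns j" "window (i, j) \<subseteq> {c<..b}"
      using J by auto
    then have "j \<in> window (i, j)"
      by (simp add: window_def)
    then have cj: "c < j" "j \<le> b"
      using j by auto
    have "lev i c \<noteq> lev i j"
    proof
      assume eq: "lev i c = lev i j"
      then have "c \<noteq> 0"
        using level_pos[OF i, of j] j by (metis level_0 less_irrefl less_le_trans zero_less_one)
      then have "c \<in> window (i, j)"
        using eq cj by (simp add: window_def)
      then show False
        using j by auto
    qed
    then have "lev i c < lev i j"
      using level_mono[of c j i] cj by linarith
    moreover have "lev i j < lev i (Suc b)"
      using j cj level_mono[of "Suc j" "Suc b" i] by (simp add: jump_slices_iff)
    ultimately show "lev i j \<in> {lev i c<..<lev i (Suc b)}"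
      by simp
  qed
  have "inj_on (lev i) J"
    using J level_inj_on_jumps by (meson inj_onI)
  then have "card J = card (lev i ` J)"
    by (simp add: card_image)
  also have "\<dots> \<le> nat (lev i (Suc b) - lev i c - 1)"
    using card_mono[OF _ sub] by (simp add: algebra_simps)
  finally have "card J \<le> nat (lev i (Suc b) - lev i c - 1)" .
  moreover have "lev i c < lev i (Suc b)"
    using sub False by auto
  ultimately have "int (card J) \<le> lev i (Suc b) - lev i c - 1"
    by simp
  then have "real (card J) \<le> real_of_int (lev i (Suc b)) - real_of_int (lev i c) - 1"
    by linarith
  also have "\<dots> < real (ns i) * real (Suc b) / real n - real (ns i) * real c / real n"
    unfolding level_def by linarith
  also have "\<dots> = real (ns i) * real (b + 1 - c) / real n"
    using \<open>c \<le> b\<close> by (simp add: of_nat_diff algebra_simps add_divide_distrib diff_divide_distrib)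
  finally show ?thesis .
qed

lemma card_jobs_in_interval:
  assumes J: "J \<subseteq> jobs_upto m" and "c \<le> b" and win: "\<And>p. p \<in> J \<Longrightarrow> window p \<subseteq> {c<..b}"
  shows "card J \<le> b - c"
proof -
  define slice where "slice i = {j. (i, j) \<in> J}" for i
  have fin: "finite J"
    using J finite_jobs_upto finite_subset by blast
  have fin_slice: "finite (slice i)" for i
    unfolding slice_def by (rule finite_subset[of _ "snd ` J"]) (use fin in force)+
  have "J = (SIGMA i:{1..u}. slice i)"
    using J by (auto simp: slice_def jobs_upto_def jump_slices_iff)
  then have "card J = (\<Sum>i=1..u. card (slice i))"
    using fin_slice by (simp add: card_SigmaI)
  then have "real (card J) = (\<Sum>i=1..u. real (card (slice i)))"
    by simp
  also have "\<dots> < (\<Sum>i=1..u. real (ns i) * real (b + 1 - c) / real n)"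
  proof (rule sum_strict_mono)
    fix i assume "i \<in> {1..u}"
    then show "real (card (slice i)) < real (ns i) * real (b + 1 - c) / real n"
      by (rule card_jobs_of_slice[OF _ \<open>c \<le> b\<close>])
        (use J win in \<open>auto simp: slice_def jobs_upto_def\<close>)
  qed (use slices_nonempty in auto)
  also have "\<dots> = (\<Sum>i=1..u. real (ns i)) * real (b + 1 - c) / real n"
    by (simp add: sum_distrib_right sum_divide_distrib)
  also have "(\<Sum>i=1..u. real (ns i)) = real n"
    by (simp add: run_total_def)
  also have "real n * real (b + 1 - c) / real n = real (b + 1 - c)"
    using total_pos by simp
  finally show ?thesis
    using \<open>c \<le> b\<close> by linarith
qed

section \<open>The greedy assignment never gets stuck\<close>

text \<open>
  The last condition is the trace that choosing the smallest free index leaves behind: every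
  smaller index of the window is occupied. It survives later assignments, as occupied indices
  stay occupied.
\<close>

definition greedy :: "(nat \<times> nat) set \<Rightarrow> (nat \<times> nat \<Rightarrow> nat) \<Rightarrow> bool" where
  "greedy P f \<longleftrightarrow> inj_on f P \<and>
     (\<forall>p\<in>P. f p \<in> window p \<and> (\<forall>r\<in>window p. r < f p \<longrightarrow> r \<in> f ` P))"

lemma greedy_not_stuck:
  assumes P: "P \<subseteq> jobs_upto b" and gr: "greedy P f"
    and q: "q \<in> jobs_upto b" "snd q = b" "q \<notin> P"
  shows "window q - f ` P \<noteq> {}"
proof
  assume "window q - f ` P = {}"
  then have full: "window q \<subseteq> f ` P"
    by blast
  \<comment> \<open>The index \<open>0\<close> lies in no window, so it is never occupied and a last free index exists.\<close>
  define c where "c = Max ({0..b} - f ` P)"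
  have "0 \<notin> f ` P"
    using gr by (force simp: greedy_def window_def)
  then have "{0..b} - f ` P \<noteq> {}"
    by auto
  then have c: "c \<in> {0..b} - f ` P"
    unfolding c_def by (intro Max_in) auto
  have occupied: "{c<..b} \<subseteq> f ` P"
  proof
    fix r assume r: "r \<in> {c<..b}"
    show "r \<in> f ` P"
    proof (rule ccontr)
      assume "r \<notin> f ` P"
      then have "r \<le> c"
        unfolding c_def using r by (intro Max_ge) auto
      then show False using r by simp
    qed
  qed
  define J where "J = {p \<in> P. c < f p}"
  have fin: "finite J"
    unfolding J_def using P finite_jobs_upto finite_subset by fastforce
  have "{c<..b} \<subseteq> f ` J"
    using occupied by (auto simp: J_def)
  then have "card {c<..b} \<le> card J"
    using fin by (rule surj_card_le[rotated])
  then have "b - c \<le> card J"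
    by simp
  moreover have "card (insert q J) = card J + 1"
    using fin q by (simp add: J_def)
  moreover have "card (insert q J) \<le> b - c"
  proof (rule card_jobs_in_interval)
    show "insert q J \<subseteq> jobs_upto b"
      using P q by (auto simp: J_def)
    show "c \<le> b"
      using c by simp
    fix p assume p: "p \<in> insert q J"
    then have "snd p \<le> b"
      using P q by (force simp: J_def jobs_upto_def)
    moreover have "c < r" if r: "r \<in> window p" for r
    proof (rule ccontr)
      assume "\<not> c < r"
      then have "r \<le> c" by simp
      have "c \<in> f ` P"
      proof (cases "p = q")
        case True
        then have "c \<in> window q"
          using window_convex[OF r \<open>r \<le> c\<close>] c q by simp
        then show ?thesis using full by blast
      next
        case False
        then have pP: "p \<in> P" "c < f p"
          using p by (auto simp: J_def)
        moreover have "f p \<le> snd p"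
          using gr pP by (auto simp: greedy_def window_def)
        ultimately have "c \<in> window p"
          using window_convex[OF r \<open>r \<le> c\<close>] by simp
        then show ?thesis
          using gr pP by (auto simp: greedy_def)
      qed
      then show False using c by simp
    qed
    ultimately show "window p \<subseteq> {c<..b}"
      by (auto simp: window_def)
  qed
  ultimately show False by simp
qed

section \<open>The algorithm computes a greedy assignment\<close>

definition realizes :: "(nat \<times> nat) set \<Rightarrow> nat \<Rightarrow> nat set \<times> (nat \<Rightarrow> nat set) \<Rightarrow> bool" where
  "realizes P j S \<longleftrightarrow> (\<exists>f. greedy P f \<and> fst S = {1..j} - f ` P \<and>
     (\<forall>i. snd S i = f ` {p \<in> P. fst p = i}))"

text \<open>The remainder set holds every free index up to \<open>j\<close>, so the set of candidates for \<open>r\<close> is the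
  free part of the window of \<open>(l, j)\<close>. It is nonempty, so its minimum is really an element.\<close>

lemma realizes_step:
  assumes P: "P \<subseteq> jobs_upto j" and q: "(l, j) \<in> jobs_upto j" "(l, j) \<notin> P"
    and S: "realizes P j (R, H)"
    and r: "r = Min {r' \<in> R. lev l r' = lev l j}"
  shows "realizes (insert (l, j) P) j (R - {r}, H(l := insert r (H l)))"
proof -
  obtain f where f: "greedy P f" and R: "R = {1..j} - f ` P"
    and H: "\<And>i. H i = f ` {p \<in> P. fst p = i}"
    using S by (auto simp: realizes_def)
  have cand: "{r' \<in> R. lev l r' = lev l j} = window (l, j) - f ` P"
    by (auto simp: R window_def)
  have fin: "finite (window (l, j) - f ` P)"
    by (simp add: window_def)
  have "r \<in> window (l, j) - f ` P"
    unfolding r cand using fin greedy_not_stuck[OF P f q(1) _ q(2)] by (intro Min_in) auto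
  then have r_mem: "r \<in> window (l, j)" "r \<notin> f ` P"
    by auto
  have r_min: "s \<in> f ` P" if "s \<in> window (l, j)" "s < r" for s
  proof (rule ccontr)
    assume "s \<notin> f ` P"
    then have "r \<le> s"
      unfolding r cand using fin that by (intro Min_le) auto
    then show False using that by simp
  qed
  define g where "g = f((l, j) := r)"
  have img: "g ` A = f ` A" if "A \<subseteq> P" for A
    unfolding g_def using that q(2) by (intro image_cong) auto
  have g_old: "g p = f p" if "p \<in> P" for p
    using that q(2) by (auto simp: g_def)
  have g_new: "g (l, j) = r"
    by (simp add: g_def)
  have g_img: "g ` insert (l, j) P = insert r (f ` P)"
    using img[of P] g_new by simp
  have "inj_on g P"
    using f g_old by (simp add: greedy_def inj_on_def)
  then have "inj_on g (insert (l, j) P)"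
    using r_mem img[of P] g_new q(2) by simp
  then have "greedy (insert (l, j) P) g"
    using f r_mem r_min g_old g_new g_img unfolding greedy_def by auto
  moreover have "R - {r} = {1..j} - g ` insert (l, j) P"
    unfolding g_img R by auto
  moreover have "(H(l := insert r (H l))) i = g ` {p \<in> insert (l, j) P. fst p = i}" for i
  proof (cases "i = l")
    case True
    then have "{p \<in> insert (l, j) P. fst p = i} = insert (l, j) {p \<in> P. fst p = i}"
      by auto
    then show ?thesis
      using True img[of "{p \<in> P. fst p = i}"] g_new H by simp
  next
    case False
    then have "{p \<in> insert (l, j) P. fst p = i} = {p \<in> P. fst p = i}"
      by auto
    then show ?thesis
      using False img[of "{p \<in> P. fst p = i}"] H by simp
  qed
  ultimately show ?thesis
    unfolding realizes_def by auto
qed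

lemma realizes_next_round:
  assumes P: "P \<subseteq> jobs_upto j" and S: "realizes P j S"
  shows "realizes P (Suc j) (insert (Suc j) (fst S), snd S)"
proof -
  obtain f where f: "greedy P f" and R: "fst S = {1..j} - f ` P"
    and H: "\<forall>i. snd S i = f ` {p \<in> P. fst p = i}"
    using S by (auto simp: realizes_def)
  have "Suc j \<notin> f ` P"
    using f P by (force simp: greedy_def window_def jobs_upto_def)
  then have "insert (Suc j) (fst S) = {1..Suc j} - f ` P"
    unfolding R by auto
  then show ?thesis
    using f H by (auto simp: realizes_def)
qed

lemma inner_state_realizes:
  fixes j :: nat
  defines "xs \<equiv> sorted_list_of_set (jump_slices u ns (Suc j))"
  assumes S: "realizes (jobs_upto j) j S" and k: "k \<le> length xs"
  shows "realizes (jobs_upto j \<union> (\<lambda>l. (l, Suc j)) ` set (take k xs)) (Suc j)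
           (inner_state u ns (Suc j) S k)"
  using k
proof (induction k)
  case 0
  then show ?case
    using realizes_next_round[OF order_refl S] by simp
next
  case (Suc k)
  let ?P = "jobs_upto j \<union> (\<lambda>l. (l, Suc j)) ` set (take k xs)"
  define l where "l = xs ! k"
  obtain R H where RH: "inner_state u ns (Suc j) S k = (R, H)"
    by (meson surj_pair)
  have set_xs: "set xs = jump_slices u ns (Suc j)" and dist: "distinct xs"
    unfolding xs_def using finite_jump_slices by auto
  have jump: "l' \<in> jump_slices u ns (Suc j)" if "l' \<in> set (take k xs)" for l'
    using that set_xs in_set_takeD by fastforce
  have l: "l \<in> jump_slices u ns (Suc j)"
    using Suc.prems set_xs unfolding l_def by (metis Suc_le_lessD nth_mem)
  have take: "take (Suc k) xs = take k xs @ [l]"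
    using Suc.prems unfolding l_def by (simp add: take_Suc_conv_app_nth)
  then have "distinct (take k xs @ [l])"
    using dist by (metis distinct_take)
  then have l_new: "l \<notin> set (take k xs)"
    by simp
  have "realizes (insert (l, Suc j) ?P) (Suc j)
          (R - {Min {r' \<in> R. lev l r' = lev l (Suc j)}},
           H(l := insert (Min {r' \<in> R. lev l r' = lev l (Suc j)}) (H l)))"
  proof (rule realizes_step[OF _ _ _ _ refl])
    show "?P \<subseteq> jobs_upto (Suc j)"
      using jump by (auto simp: jobs_upto_def)
    show "(l, Suc j) \<in> jobs_upto (Suc j)"
      using l by (auto simp: jobs_upto_def)
    show "(l, Suc j) \<notin> ?P"
      using l_new by (auto simp: jobs_upto_def)
    show "realizes ?P (Suc j) (R, H)"
      using Suc RH by simp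
  qed
  moreover have "inner_state u ns (Suc j) S (Suc k) =
          (R - {Min {r' \<in> R. lev l r' = lev l (Suc j)}},
           H(l := insert (Min {r' \<in> R. lev l r' = lev l (Suc j)}) (H l)))"
    using RH by (simp add: Let_def l_def xs_def)
  moreover have "insert (l, Suc j) ?P =
      jobs_upto j \<union> (\<lambda>l. (l, Suc j)) ` set (take (Suc k) xs)"
    unfolding take by auto
  ultimately show ?case
    by simp
qed

lemma outer_state_realizes: "realizes (jobs_upto j) j (outer_state u ns j)"
proof (induction j)
  case 0
  show ?case
    by (simp add: realizes_def greedy_def jobs_upto_def)
next
  case (Suc j)
  let ?xs = "sorted_list_of_set (jump_slices u ns (Suc j))"
  have len: "theta u ns (Suc j) = length ?xs"
    by (simp add: theta_eq_card)
  have "jobs_upto j \<union> (\<lambda>l. (l, Suc j)) ` set ?xs = jobs_upto (Suc j)"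
    using finite_jump_slices by (auto simp: jobs_upto_def le_Suc_eq)
  then show ?case
    using inner_state_realizes[OF Suc, of "theta u ns (Suc j)"] by (simp add: len)
qed

section \<open>The slice sets\<close>

lemma slice_sets_greedy:
  obtains f where "greedy (jobs_upto n) f"
    and "\<And>i. slice_set u ns i = f ` {p \<in> jobs_upto n. fst p = i}"
  using outer_state_realizes[of n] unfolding realizes_def slice_set_def by auto

lemma slice_set_range: "slice_set u ns i \<subseteq> {1..n}"
proof -
  obtain f where f: "greedy (jobs_upto n) f"
    and H: "slice_set u ns i = f ` {p \<in> jobs_upto n. fst p = i}"
    using slice_sets_greedy by metis
  have "f p \<in> {1..n}" if "p \<in> jobs_upto n" for p
    using f that by (fastforce simp: greedy_def window_def jobs_upto_def)
  then show ?thesis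
    unfolding H by auto
qed

text \<open>Every window of slice \<open>i\<close> contributes its job's index, and jobs of one slice have
  different levels.\<close>

lemma level_bij_slice_set:
  assumes i: "i \<in> {1..u}"
  shows "bij_betw (lev i) (slice_set u ns i) {1..int (ns i)}"
proof -
  obtain f where f: "greedy (jobs_upto n) f"
    and H: "slice_set u ns i = f ` {p \<in> jobs_upto n. fst p = i}"
    using slice_sets_greedy by metis
  have lev_f: "lev i (f (i, j)) = lev i j" if "(i, j) \<in> jobs_upto n" for j
    using f that by (force simp: greedy_def window_def)
  have "inj_on (lev i) (slice_set u ns i)"
  proof (rule inj_onI)
    fix x y assume "x \<in> slice_set u ns i" "y \<in> slice_set u ns i" and eq: "lev i x = lev i y"
    then obtain j j' where j: "x = f (i, j)" "(i, j) \<in> jobs_upto n"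
      and j': "y = f (i, j')" "(i, j') \<in> jobs_upto n"
      unfolding H by auto
    then have "j = j'"
      using eq lev_f level_inj_on_jumps[of i j j'] by (auto simp: jobs_upto_def)
    then show "x = y"
      using j j' by simp
  qed
  moreover have "lev i ` slice_set u ns i = {1..int (ns i)}"
  proof (intro equalityI subsetI)
    fix k assume "k \<in> lev i ` slice_set u ns i"
    then obtain r where r: "r \<in> {1..n}" "k = lev i r"
      using slice_set_range by blast
    then show "k \<in> {1..int (ns i)}"
      using level_pos[OF i, of r] level_mono[of r n i] level_total[of i] by simp
  next
    fix k :: int assume "k \<in> {1..int (ns i)}"
    then have "nat k \<in> {1..ns i}" and "int (nat k) = k"
      by auto
    then obtain j where "j \<in> {1..n}" "i \<in> jump_slices u ns j" "lev i j = k"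
      using jump_at_every_level[OF i] by metis
    then have job: "(i, j) \<in> jobs_upto n" and "lev i j = k"
      by (auto simp: jobs_upto_def)
    then have "k = lev i (f (i, j))"
      using lev_f by simp
    moreover have "f (i, j) \<in> slice_set u ns i"
      unfolding H using job by (intro imageI) simp
    ultimately show "k \<in> lev i ` slice_set u ns i"
      by (rule image_eqI)
  qed
  ultimately show ?thesis
    by (simp add: bij_betw_def)
qed

lemma card_slice_set: "i \<in> {1..u} \<Longrightarrow> card (slice_set u ns i) = ns i"
  using bij_betw_same_card[OF level_bij_slice_set] by simp

lemma Union_slice_sets: "(\<Union>i\<in>{1..u}. slice_set u ns i) = {1..n}"
proof (rule card_subset_eq)
  show "(\<Union>i\<in>{1..u}. slice_set u ns i) \<subseteq> {1..n}"
    using slice_set_range by blast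
  obtain f where f: "greedy (jobs_upto n) f"
    and H: "\<And>i. slice_set u ns i = f ` {p \<in> jobs_upto n. fst p = i}"
    using slice_sets_greedy by metis
  have "slice_set u ns i \<inter> slice_set u ns j = {}" if "i \<noteq> j" for i j
    unfolding H using f that by (auto simp: greedy_def inj_on_def)
  then have "card (\<Union>i\<in>{1..u}. slice_set u ns i) = (\<Sum>i=1..u. card (slice_set u ns i))"
    using finite_subset[OF slice_set_range] by (intro card_UN_disjoint) auto
  also have "\<dots> = n"
    by (simp add: card_slice_set run_total_def)
  finally show "card (\<Union>i\<in>{1..u}. slice_set u ns i) = card {1..n}"
    by simp
qed simp

end

section \<open>From row indices to points\<close>

text \<open>
  With \<open>L = M m\<close> the scaled value \<open>L r / n\<close> and all multiples of \<open>M\<close> are integers. So if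
  \<open>L r / n\<close> exceeds \<open>(k - 1) M\<close>, it does so by at least \<open>1 > e\<close>.
\<close>

lemma jitter_preserves_cell:
  fixes m n L r :: nat and e :: real
  assumes "m dvd L" "n dvd L" "0 < L" "0 < e" "e < 1"
  shows "\<lceil>real m * ((real L * real r / real n - e) / real L)\<rceil> = \<lceil>real m * real r / real n\<rceil>"
proof -
  obtain M where M: "L = m * M"
    using \<open>m dvd L\<close> by blast
  obtain N where N: "L = n * N"
    using \<open>n dvd L\<close> by blast
  have pos: "0 < m" "0 < M" "0 < n" "0 < N"
    using \<open>0 < L\<close> M N by (metis nat_0_less_mult_iff)+
  define k where "k = \<lceil>real m * real r / real n\<rceil>"
  have scaled: "real L * real r / real n = real (N * r)"
    using pos by (simp add: N)
  have cell: "real m * real r / real n = real (N * r) / real M"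
    using pos scaled by (simp add: M field_simps)
  have point: "real m * ((real L * real r / real n - e) / real L) = (real (N * r) - e) / real M"
    unfolding scaled using pos by (simp add: M)
  have "of_int (k - 1) < real (N * r) / real M" and upper: "real (N * r) / real M \<le> of_int k"
    unfolding k_def cell by linarith+
  then have "of_int (k - 1) * real M < real (N * r)"
    using pos by (simp add: pos_less_divide_eq)
  then have "of_int ((k - 1) * int M) < (of_int (int (N * r)) :: real)"
    by simp
  then have "(k - 1) * int M + 1 \<le> int (N * r)"
    by (simp only: of_int_less_iff)
  then have "of_int ((k - 1) * int M + 1) \<le> (of_int (int (N * r)) :: real)"
    by (simp only: of_int_le_iff)
  then have "of_int (k - 1) * real M < real (N * r) - e"
    using \<open>e < 1\<close> by simp
  then have "of_int (k - 1) < (real (N * r) - e) / real M"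
    using pos by (simp add: pos_less_divide_eq)
  moreover have "(real (N * r) - e) / real M \<le> real (N * r) / real M"
    using pos \<open>0 < e\<close> by (simp add: divide_right_mono)
  ultimately have "\<lceil>(real (N * r) - e) / real M\<rceil> = k"
    using upper by (intro ceiling_unique) auto
  then show ?thesis
    unfolding point k_def .
qed

lemma cells_of_generated_slice:
  assumes "h \<in> permutations_of_set (slice_set u ns i)"
    and "length \<epsilon> = length h" "set \<epsilon> \<subseteq> {0<..<1}"
    and "ds = map2 (\<lambda>x e. (x - e) / real (run_lcm u ns))
           (map (\<lambda>x. real (run_lcm u ns) * real x / real (run_total u ns)) h) \<epsilon>"
    and "m dvd run_lcm u ns" "0 < run_lcm u ns"
  shows "map (\<lambda>x. \<lceil>real m * x\<rceil>) ds = map (\<lambda>r. \<lceil>real m * real r / real (run_total u ns)\<rceil>) h"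
proof (rule nth_equalityI)
  show len: "length (map (\<lambda>x. \<lceil>real m * x\<rceil>) ds) =
      length (map (\<lambda>r. \<lceil>real m * real r / real (run_total u ns)\<rceil>) h)"
    using assms by simp
  fix s assume "s < length (map (\<lambda>x. \<lceil>real m * x\<rceil>) ds)"
  then have s: "s < length h" "s < length \<epsilon>" "s < length ds"
    using assms len by auto
  then have "\<epsilon> ! s \<in> {0<..<1}"
    using assms nth_mem by blast
  moreover have "run_total u ns dvd run_lcm u ns"
    unfolding run_lcm_def by (rule dvd_Lcm) simp
  ultimately show "map (\<lambda>x. \<lceil>real m * x\<rceil>) ds ! s =
      map (\<lambda>r. \<lceil>real m * real r / real (run_total u ns)\<rceil>) h ! s"
    using s assms jitter_preserves_cell[of m "run_lcm u ns" "run_total u ns" "\<epsilon> ! s" "h ! s"]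
    by simp
qed

text \<open>As many points as cells: if every cell is hit, then no cell is hit twice.\<close>

lemma one_point_per_cell:
  fixes xs :: "real list"
  assumes len: "length xs = m" and cells: "set (map (\<lambda>x. \<lceil>real m * x\<rceil>) xs) = {1..int m}"
    and k: "k \<in> {1..m}"
  shows "\<exists>!s. s < m \<and> xs ! s \<in> {(real k - 1) / real m <.. real k / real m}"
proof -
  let ?cs = "map (\<lambda>x. \<lceil>real m * x\<rceil>) xs"
  have m: "0 < m"
    using k by auto
  have cell: "x \<in> {(real k - 1) / real m <.. real k / real m} \<longleftrightarrow> \<lceil>real m * x\<rceil> = int k" for x
    using m by (simp add: ceiling_eq_iff pos_divide_less_eq pos_le_divide_eq mult.commute)
  have "distinct ?cs"
    by (rule card_distinct) (simp only: cells length_map len card_atLeastAtMost_int nat_int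
        add_diff_cancel_right')
  then have "inj_on ((!) ?cs) {..<m}"
    using len by (intro inj_on_nth) auto
  moreover have "int k \<in> set ?cs"
    unfolding cells using k by simp
  then obtain s where "s < m" "?cs ! s = int k"
    using len by (auto simp: in_set_conv_nth)
  ultimately have "\<exists>!s. s < m \<and> ?cs ! s = int k"
    by (auto simp: inj_on_def)
  then show ?thesis
    unfolding cell using len by (metis nth_map)
qed

theorem theorem1:
  fixes u q n :: nat and ns :: "nat \<Rightarrow> nat"
    and D :: "real list list" and d :: "real list" and ds :: "nat \<Rightarrow> real list"
  assumes "1 \<le> u"
    and "\<forall>i\<in>{1..u}. 0 < ns i"
    and "n = run_total u ns"
    and "FSLHD u ns q D"
    and "d \<in> set D"
    and "generated_column u ns ds d"
  shows "(length d = n \<and>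
          (\<forall>k\<in>{1..n}. \<exists>!s. s < n \<and> d ! s \<in> {(real k - 1) / real n <.. real k / real n})) \<and>
         (\<forall>i\<in>{1..u}. length (ds i) = ns i \<and>
          (\<forall>k\<in>{1..ns i}. \<exists>!s. s < ns i \<and>
             ds i ! s \<in> {(real k - 1) / real (ns i) <.. real k / real (ns i)}))"
proof -
  interpret run_sizes u ns
    using assms by unfold_locales auto
  let ?L = "run_lcm u ns"
  have n_dvd: "n dvd ?L" and ns_dvd: "\<And>i. i \<in> {1..u} \<Longrightarrow> ns i dvd ?L"
    unfolding run_lcm_def assms(3) by (auto intro!: dvd_Lcm)
  have n_pos: "0 < n"
    using total_pos assms(3) by simp
  have "0 \<notin> insert (run_total u ns) (ns ` {1..u})"
    using total_pos run_size_pos by force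
  then have L_pos: "0 < ?L"
    unfolding run_lcm_def by (auto simp: Lcm_0_iff intro!: Nat.gr0I)
  have gen: "generated_slice u ns i (ds i)" if "i \<in> {1..u}" for i
    using assms(6) that by (auto simp: generated_column_def)
  have d: "d = concat (map ds [1..<Suc u])"
    using assms(6) by (simp add: generated_column_def)
  have slice: "length (ds i) = ns i
      \<and> set (map (\<lambda>x. \<lceil>real (ns i) * x\<rceil>) (ds i)) = {1..int (ns i)}
      \<and> set (map (\<lambda>x. \<lceil>real n * x\<rceil>) (ds i)) = int ` slice_set u ns i"
    if i: "i \<in> {1..u}" for i
  proof -
    obtain h \<epsilon> where h: "h \<in> permutations_of_set (slice_set u ns i)"
      and \<epsilon>: "length \<epsilon> = length h" "set \<epsilon> \<subseteq> {0<..<1}"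
      and ds: "ds i = map2 (\<lambda>x e. (x - e) / real ?L)
           (map (\<lambda>x. real ?L * real x / real (run_total u ns)) h) \<epsilon>"
      using gen[OF i] unfolding generated_slice_def by blast
    note cells = cells_of_generated_slice[OF h \<epsilon> ds _ L_pos]
    have h_set: "set h = slice_set u ns i" and "distinct h"
      using h by (auto simp: permutations_of_set_def)
    then have "length h = ns i"
      using distinct_card[of h] card_slice_set[OF i] by simp
    then have "length (ds i) = ns i"
      using \<epsilon> by (simp add: ds)
    moreover have "map (\<lambda>x. \<lceil>real (ns i) * x\<rceil>) (ds i) = map (lev i) h"
      using cells[OF ns_dvd[OF i]] by (simp add: level_def)
    then have "set (map (\<lambda>x. \<lceil>real (ns i) * x\<rceil>) (ds i)) = {1..int (ns i)}"
      using level_bij_slice_set[OF i] h_set by (simp add: bij_betw_def)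
    moreover have "map (\<lambda>x. \<lceil>real n * x\<rceil>) (ds i) = map int h"
      using cells[OF n_dvd] n_pos by (simp add: assms(3))
    then have "set (map (\<lambda>x. \<lceil>real n * x\<rceil>) (ds i)) = int ` slice_set u ns i"
      using h_set by simp
    ultimately show ?thesis by blast
  qed
  have range: "set [1..<Suc u] = {1..u}"
    by auto
  have "length d = sum_list (map (\<lambda>i. length (ds i)) [1..<Suc u])"
    by (simp add: d length_concat comp_def)
  also have "\<dots> = (\<Sum>i=1..u. length (ds i))"
    by (simp only: sum_list_distinct_conv_sum_set distinct_upt range)
  also have "\<dots> = n"
    using slice by (simp add: assms(3) run_total_def)
  finally have len: "length d = n" .
  have "set (map (\<lambda>x. \<lceil>real n * x\<rceil>) d) =
      (\<Union>i\<in>{1..u}. set (map (\<lambda>x. \<lceil>real n * x\<rceil>) (ds i)))"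
    unfolding d set_map set_concat range by blast
  also have "\<dots> = int ` (\<Union>i\<in>{1..u}. slice_set u ns i)"
    using slice by (simp add: image_UN)
  also have "\<dots> = {1..int n}"
    unfolding Union_slice_sets by (simp add: assms(3) image_int_atLeastAtMost)
  finally have "set (map (\<lambda>x. \<lceil>real n * x\<rceil>) d) = {1..int n}" .
  note column = one_point_per_cell[OF len this]
  show ?thesis
  proof (intro conjI ballI)
    show "length d = n"
      by (rule len)
    show "\<exists>!s. s < n \<and> d ! s \<in> {(real k - 1) / real n <.. real k / real n}" if "k \<in> {1..n}" for k
      using that by (rule column)
    fix i assume "i \<in> {1..u}"
    note slice_i = slice[OF this]
    show "length (ds i) = ns i"
      using slice_i by (rule conjunct1)
    show "\<exists>!s. s < ns i \<and> ds i ! s \<in> {(real k - 1) / real (ns i) <.. real k / real (ns i)}"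
      if "k \<in> {1..ns i}" for k
      using slice_i that by (intro one_point_per_cell) auto
  qed
qed

end
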